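(* Let $U=(U^1,U^2)=\nabla\psi+W$, with $\mathrm{div}\,W=0$, be a $C^2$ function on $\mathbb R^2$ which, together with a density $\rho>0$ and a pressure $p=p(\rho)$ with $p'(\rho)>0$, satisfies $$\begin{cases}\mathrm{div}(\rho U)+2\rho=0,\\ \mathrm{div}(\rho\,U\otimes U)+\nabla p+3\rho U=0.\end{cases}$$ Let $h=h(\rho)$ be the enthalpy, $h'(\rho)=p'(\rho)/\rho$, and let $\omega=\partial_{\xi_1}U^2-\partial_{\xi_2}U^1$. Then the following Bernoulli type equation is satisfied: $$h+\psi+\tfrac12|U|^2=\int_0^{\xi_1}G(s,0)\,ds+\int_0^{\xi_2}H(\xi_1,s)\,ds+C,\qquad C\in\mathbb R \text{ a constant},$$ where $$G:=\omega U^2-W^1,\qquad H:=-\omega U^1-W^2 .$$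
   Context: All functions depend on $\xi=(\xi_1,\xi_2)\in\mathbb R^2$ and all derivatives are with respect to $\xi$; superscripts denote vector components; $\mathrm{div}(\rho U\otimes U)$ is the vector with $i$-th component $\mathrm{div}(\rho U^iU)$. The functions $\rho$, $\psi$, $W$ are assumed sufficiently regular for the equations to hold classically. *)

theory Defs
  imports "HOL-Analysis.Analysis"
begin

definition partial :: "'n::finite \<Rightarrow> (real ^ 'n \<Rightarrow> real) \<Rightarrow> real ^ 'n \<Rightarrow> real" where
  "partial i f x = deriv (\<lambda>t. f (x + t *\<^sub>R axis i 1)) 0"

definition grad :: "(real ^ 'n::finite \<Rightarrow> real) \<Rightarrow> real ^ 'n \<Rightarrow> real ^ 'n" where
  "grad f x = (\<chi> i. partial i f x)"

definition divergence :: "(real ^ 'n::finite \<Rightarrow> real ^ 'n) \<Rightarrow> real ^ 'n \<Rightarrow> real" where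
  "divergence F x = (\<Sum>i\<in>UNIV. partial i (\<lambda>y. F y $ i) x)"

definition tensor :: "real ^ 'n::finite \<Rightarrow> real ^ 'n \<Rightarrow> real ^ 'n ^ 'n" where
  "tensor u v = (\<chi> i j. u $ i * v $ j)"

text \<open>The divergence of a matrix field is taken along rows, so that the \<open>i\<close>-th component of
  the divergence of \<open>\<rho> U \<otimes> U\<close> is the divergence of \<open>\<rho> U\<^sup>i U\<close>.\<close>

definition row_divergence ::
    "(real ^ 'n::finite \<Rightarrow> real ^ 'n ^ 'n) \<Rightarrow> real ^ 'n \<Rightarrow> real ^ 'n" where
  "row_divergence T x = (\<chi> i. divergence (\<lambda>y. T y $ i) x)"

definition curl2 :: "(real ^ 2 \<Rightarrow> real ^ 2) \<Rightarrow> real ^ 2 \<Rightarrow> real" where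
  "curl2 F x = partial 1 (\<lambda>y. F y $ 2) x - partial 2 (\<lambda>y. F y $ 1) x"

text \<open>\<open>C_k k f\<close>: the scalar function \<open>f\<close> is of class \<open>C\<close> to the power \<open>k\<close> on the whole space.
  Differentiability is Frechet differentiability, so each partial derivative occurring below is
  an actual one and not a default value of \<open>deriv\<close>.\<close>

primrec C_k :: "nat \<Rightarrow> (real ^ 'n::finite \<Rightarrow> real) \<Rightarrow> bool" where
  "C_k 0 f \<longleftrightarrow> continuous_on UNIV f"
| "C_k (Suc k) f \<longleftrightarrow> (\<forall>x. f differentiable (at x)) \<and> (\<forall>i. C_k k (partial i f))"

end

theory Submission
  imports Defs
begin

text \<open>Expanding the momentum equation with the product rule and inserting the mass equation
  gives \<open>(U \<cdot> \<nabla>)U + U + \<nabla>h = 0\<close> after division by \<open>\<rho>\<close>. The convective term is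
  \<open>\<nabla>(|U|\<^sup>2/2)\<close> plus a rotation of \<open>\<omega> U\<close>, and \<open>U = \<nabla>\<psi> + W\<close>, so the gradient of
  \<open>h + \<psi> + |U|\<^sup>2/2\<close> is \<open>(G, H)\<close>. As \<open>G\<close> and \<open>H\<close> are continuous, this gradient can be
  integrated from the origin, first along \<open>\<xi>\<^sub>1\<close> and then along \<open>\<xi>\<^sub>2\<close>.\<close>

text \<open>By the chain rule, the Frechet derivative applied to the axis vector is the derivative
  along the line. This turns \<open>partial\<close>, a \<open>deriv\<close> at parameter 0, into a
  genuine derivative at every parameter \<open>s\<close>.\<close>

lemma has_real_derivative_line:
  fixes f :: "real ^ 'n::finite \<Rightarrow> real"
  assumes "f differentiable (at (x + s *\<^sub>R axis i 1))"
  shows "((\<lambda>t. f (x + t *\<^sub>R axis i 1)) has_real_derivative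
           partial i f (x + s *\<^sub>R axis i 1)) (at s)"
proof -
  let ?e = "axis i 1 :: real ^ 'n"
  obtain D where D: "(f has_derivative D) (at (x + s *\<^sub>R ?e))"
    using assms by (auto simp: differentiable_def)
  \<comment> \<open>\<open>y\<close> and \<open>r\<close> stay free because two parametrisations
    through the same point are compared: from \<open>x\<close> at parameter \<open>s\<close>, and
    from the shifted point at parameter 0, as in \<open>partial\<close>.\<close>
  have *: "((\<lambda>t. f (y + t *\<^sub>R ?e)) has_real_derivative D ?e) (at r)"
    if "y + r *\<^sub>R ?e = x + s *\<^sub>R ?e" for y r
  proof -
    have "((\<lambda>t. y + t *\<^sub>R ?e) has_derivative (\<lambda>t. t *\<^sub>R ?e)) (at r)"
      by (auto intro!: derivative_eq_intros)
    moreover have "(f has_derivative D) (at (y + r *\<^sub>R ?e))"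
      using D that by simp
    ultimately have "((\<lambda>t. f (y + t *\<^sub>R ?e)) has_derivative (\<lambda>t. D (t *\<^sub>R ?e))) (at r)"
      by (rule has_derivative_compose)
    moreover have "D (t *\<^sub>R ?e) = D ?e * t" for t
      using linear_scale[OF has_derivative_linear[OF D]] by simp
    ultimately show ?thesis
      by (simp add: has_field_derivative_def)
  qed
  have "partial i f (x + s *\<^sub>R ?e) = D ?e"
    unfolding partial_def by (rule DERIV_imp_deriv, rule *) simp
  with *[of x s] show ?thesis by simp
qed

lemma has_real_derivative_partial:
  fixes f :: "real ^ 'n::finite \<Rightarrow> real"
  assumes "f differentiable (at x)"
  shows "((\<lambda>t. f (x + t *\<^sub>R axis i 1)) has_real_derivative partial i f x) (at 0)"
  using has_real_derivative_line[of f x 0 i] assms by simp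

lemma partial_add:
  fixes f g :: "real ^ 'n::finite \<Rightarrow> real"
  assumes "f differentiable (at x)" "g differentiable (at x)"
  shows "partial i (\<lambda>y. f y + g y) x = partial i f x + partial i g x"
  unfolding partial_def[of i "\<lambda>y. f y + g y"]
  by (intro DERIV_imp_deriv DERIV_add has_real_derivative_partial assms)

lemma partial_mult:
  fixes f g :: "real ^ 'n::finite \<Rightarrow> real"
  assumes "f differentiable (at x)" "g differentiable (at x)"
  shows "partial i (\<lambda>y. f y * g y) x = partial i f x * g x + f x * partial i g x"
  unfolding partial_def[of i "\<lambda>y. f y * g y"]
  using DERIV_mult[OF assms[THEN has_real_derivative_partial, of i]]
  by (intro DERIV_imp_deriv) (simp add: algebra_simps)

text \<open>The outer function is differentiated only at \<open>f x\<close>, which suits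
  \<open>p\<close> and \<open>h\<close>: their derivatives are controlled only at positive
  densities.\<close>

lemma partial_compose:
  fixes f :: "real ^ 'n::finite \<Rightarrow> real"
  assumes "(g has_real_derivative g') (at (f x))" "f differentiable (at x)"
  shows "partial i (\<lambda>y. g (f y)) x = g' * partial i f x"
  unfolding partial_def[of i "\<lambda>y. g (f y)"]
  using assms by (intro DERIV_imp_deriv DERIV_chain2[of g] has_real_derivative_partial) auto

text \<open>The fundamental theorem of calculus along a coordinate line. The interval integral is
  oriented, so \<open>a\<close> may be negative.\<close>

lemma LBINT_partial_line:
  fixes f :: "real ^ 'n::finite \<Rightarrow> real" and a :: real
  assumes "\<And>y. f differentiable (at y)" "continuous_on UNIV (partial i f)"
  shows "(LBINT s=0..a. partial i f (x + s *\<^sub>R axis i 1)) = f (x + a *\<^sub>R axis i 1) - f x"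
proof -
  have "(LBINT s=ereal 0..a. partial i f (x + s *\<^sub>R axis i 1))
      = f (x + a *\<^sub>R axis i 1) - f (x + 0 *\<^sub>R axis i 1)"
  proof (rule interval_integral_FTC_finite)
    show "continuous_on {min 0 a..max 0 a} (\<lambda>s. partial i f (x + s *\<^sub>R axis i 1))"
      by (intro continuous_on_compose2[OF assms(2)] continuous_intros) auto
    show "((\<lambda>t. f (x + t *\<^sub>R axis i 1)) has_vector_derivative
            partial i f (x + s *\<^sub>R axis i 1)) (at s within {min 0 a..max 0 a})" for s
      by (rule has_vector_derivative_at_within)
        (simp flip: has_real_derivative_iff_has_vector_derivative
          add: has_real_derivative_line assms(1))
  qed
  then show ?thesis by (simp add: zero_ereal_def)
qed

theorem theorem2p8:
  fixes U W :: "real ^ 2 \<Rightarrow> real ^ 2"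
    and \<rho> \<psi> \<omega> G H :: "real ^ 2 \<Rightarrow> real"
    and p h :: "real \<Rightarrow> real"
  assumes U_C2: "\<And>i. C_k 2 (\<lambda>\<xi>. U \<xi> $ i)"
    and \<rho>_diff: "\<And>\<xi>. \<rho> differentiable (at \<xi>)"
    and \<psi>_diff: "\<And>\<xi>. \<psi> differentiable (at \<xi>)"
    and W_diff: "\<And>\<xi>. W differentiable (at \<xi>)"
    and U_eq: "\<And>\<xi>. U \<xi> = grad \<psi> \<xi> + W \<xi>"
    and div_W: "\<And>\<xi>. divergence W \<xi> = 0"
    and \<rho>_pos: "\<And>\<xi>. \<rho> \<xi> > 0"
    and p_diff: "\<And>r. r > 0 \<Longrightarrow> p differentiable (at r)"
    and p_deriv_pos: "\<And>r. r > 0 \<Longrightarrow> deriv p r > 0"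
    and mass: "\<And>\<xi>. divergence (\<lambda>\<xi>. \<rho> \<xi> *\<^sub>R U \<xi>) \<xi> + 2 * \<rho> \<xi> = 0"
    and momentum: "\<And>\<xi>. row_divergence (\<lambda>\<xi>. \<rho> \<xi> *\<^sub>R tensor (U \<xi>) (U \<xi>)) \<xi>
                      + grad (\<lambda>\<xi>. p (\<rho> \<xi>)) \<xi> + (3 * \<rho> \<xi>) *\<^sub>R U \<xi> = 0"
    and h_deriv: "\<And>r. r > 0 \<Longrightarrow> (h has_real_derivative deriv p r / r) (at r)"
    and \<omega>_eq: "\<And>\<xi>. \<omega> \<xi> = curl2 U \<xi>"
    and G_eq: "\<And>\<xi>. G \<xi> = \<omega> \<xi> * U \<xi> $ 2 - W \<xi> $ 1"
    and H_eq: "\<And>\<xi>. H \<xi> = - \<omega> \<xi> * U \<xi> $ 1 - W \<xi> $ 2"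
  shows "\<exists>C::real. \<forall>\<xi>.
           h (\<rho> \<xi>) + \<psi> \<xi> + 1 / 2 * (norm (U \<xi>))\<^sup>2
           = (LBINT s=0..\<xi> $ 1. G (vector [s, 0]))
             + (LBINT s=0..\<xi> $ 2. H (vector [\<xi> $ 1, s])) + C"
proof -
  let ?u = "\<lambda>i \<xi>. U \<xi> $ i"
  define B where "B \<xi> = h (\<rho> \<xi>) + \<psi> \<xi> + 1 / 2 * (?u 1 \<xi> * ?u 1 \<xi> + ?u 2 \<xi> * ?u 2 \<xi>)" for \<xi>
  \<comment> \<open>Writing 2 as \<open>Suc (Suc 0)\<close> lets the recursion of \<open>C_k\<close>
    unfold.\<close>
  have U_diff: "?u i differentiable (at \<xi>)" for i \<xi>
    using U_C2[of i] by (simp add: numeral_2_eq_2)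
  have U_partial_cont: "continuous_on UNIV (partial j (?u i))" for i j
  proof -
    have *: "partial j (?u i) differentiable (at \<xi>)" for \<xi>
      using U_C2[of i] by (simp add: numeral_2_eq_2)
    show "continuous_on UNIV (partial j (?u i))"
      by (intro differentiable_imp_continuous_on differentiable_at_imp_differentiable_on) (rule *)
  qed
  have U_cont: "continuous_on UNIV (?u i)" for i
    by (intro differentiable_imp_continuous_on differentiable_at_imp_differentiable_on) (rule U_diff)
  have W_cont: "continuous_on UNIV W"
    by (intro differentiable_imp_continuous_on differentiable_at_imp_differentiable_on) (rule W_diff)
  have \<omega>_cont: "continuous_on UNIV \<omega>"
    unfolding \<omega>_eq[abs_def] curl2_def[abs_def] by (intro continuous_intros U_partial_cont)

  have euler: "?u 1 \<xi> * partial 1 (?u i) \<xi> + ?u 2 \<xi> * partial 2 (?u i) \<xi> + ?u i \<xi>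
      + deriv p (\<rho> \<xi>) / \<rho> \<xi> * partial i \<rho> \<xi> = 0" for i \<xi>
  proof -
    have mass': "(\<Sum>j\<in>UNIV. partial j \<rho> \<xi> * ?u j \<xi> + \<rho> \<xi> * partial j (?u j) \<xi>) = - 2 * \<rho> \<xi>"
      using mass[of \<xi>] by (simp add: divergence_def partial_mult \<rho>_diff U_diff)
    have p_partial: "partial i (\<lambda>\<xi>. p (\<rho> \<xi>)) \<xi> = deriv p (\<rho> \<xi>) * partial i \<rho> \<xi>"
      by (rule partial_compose)
        (use p_diff \<rho>_pos \<rho>_diff in \<open>auto simp: DERIV_deriv_iff_real_differentiable\<close>)
    have "(\<Sum>j\<in>UNIV. partial j (\<lambda>\<xi>. \<rho> \<xi> * (?u i \<xi> * ?u j \<xi>)) \<xi>)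
        + deriv p (\<rho> \<xi>) * partial i \<rho> \<xi> + 3 * \<rho> \<xi> * ?u i \<xi> = 0"
      using arg_cong[OF momentum[of \<xi>], of "\<lambda>v. v $ i"]
      by (simp add: row_divergence_def divergence_def tensor_def grad_def p_partial)
    \<comment> \<open>The product rule is grouped so that the factor of \<open>?u i \<xi>\<close> is
      the expanded divergence of \<rho> U. By \<open>mass'\<close> it equals -2 \<rho>, so 3 \<rho>
      U drops to \<rho> U, and \<rho> > 0 can be divided out.\<close>
    then have "?u i \<xi> * (\<Sum>j\<in>UNIV. partial j \<rho> \<xi> * ?u j \<xi> + \<rho> \<xi> * partial j (?u j) \<xi>)
        + \<rho> \<xi> * (?u 1 \<xi> * partial 1 (?u i) \<xi> + ?u 2 \<xi> * partial 2 (?u i) \<xi>)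
        + deriv p (\<rho> \<xi>) * partial i \<rho> \<xi> + 3 * \<rho> \<xi> * ?u i \<xi> = 0"
      by (simp add: partial_mult \<rho>_diff U_diff sum_2 algebra_simps)
    then show ?thesis
      unfolding mass' using \<rho>_pos[of \<xi>] by (simp add: field_simps)
  qed

  have h_diff: "(\<lambda>\<xi>. h (\<rho> \<xi>)) differentiable (at \<xi>)" for \<xi>
  proof -
    have "h differentiable (at (\<rho> \<xi>))"
      using h_deriv[OF \<rho>_pos] real_differentiable_def by blast
    from differentiable_chain_at[OF \<rho>_diff this] show ?thesis
      by (simp add: o_def)
  qed
  have B_diff: "B differentiable (at \<xi>)" for \<xi>
    unfolding B_def[abs_def]
    by (intro differentiable_add differentiable_mult h_diff \<psi>_diff U_diff differentiable_const)
  have B_partial: "partial i B \<xi> = deriv p (\<rho> \<xi>) / \<rho> \<xi> * partial i \<rho> \<xi> + partial i \<psi> \<xi>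
      + (?u 1 \<xi> * partial i (?u 1) \<xi> + ?u 2 \<xi> * partial i (?u 2) \<xi>)" for i \<xi>
  proof -
    \<comment> \<open>The constant factor comes out by the chain rule, with multiplication by 1/2 as
      outer function.\<close>
    have "partial i (\<lambda>\<xi>. 1 / 2 * (?u 1 \<xi> * ?u 1 \<xi> + ?u 2 \<xi> * ?u 2 \<xi>)) \<xi>
        = 1 / 2 * partial i (\<lambda>\<xi>. ?u 1 \<xi> * ?u 1 \<xi> + ?u 2 \<xi> * ?u 2 \<xi>) \<xi>"
      by (rule partial_compose[of "(*) (1 / 2)"])
        (auto intro!: derivative_eq_intros differentiable_add differentiable_mult U_diff)
    then show ?thesis
      unfolding B_def[abs_def]
      using partial_compose[OF h_deriv[OF \<rho>_pos] \<rho>_diff]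
      by (simp add: partial_add partial_mult h_diff \<psi>_diff U_diff \<rho>_diff)
  qed
  have \<psi>_partial: "partial i \<psi> \<xi> = ?u i \<xi> - W \<xi> $ i" for i \<xi>
    using U_eq[of \<xi>] by (simp add: grad_def)
  \<comment> \<open>Subtracting \<open>euler\<close> cancels the enthalpy term, U^1 and U^1 times
    its first partial. What remains is U^2 times the curl, minus W^1.\<close>
  have B1: "partial 1 B = G"
    using euler[where i = 1]
    by (auto simp: fun_eq_iff B_partial \<psi>_partial G_eq \<omega>_eq curl2_def algebra_simps)
  have B2: "partial 2 B = H"
    using euler[where i = 2]
    by (auto simp: fun_eq_iff B_partial \<psi>_partial H_eq \<omega>_eq curl2_def algebra_simps)
  have G_cont: "continuous_on UNIV G" and H_cont: "continuous_on UNIV H"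
    unfolding G_eq[abs_def] H_eq[abs_def]
    by (intro continuous_intros \<omega>_cont U_cont W_cont)+

  have B_line: "B \<xi> = (LBINT s=0..\<xi> $ 1. G (vector [s, 0]))
      + (LBINT s=0..\<xi> $ 2. H (vector [\<xi> $ 1, s])) + B 0" for \<xi>
  proof -
    \<comment> \<open>These rules parametrise the two legs of the path from the origin through
      (\<xi>_1, 0) to \<xi>. The first matches a literal \<open>0 +\<close>, hence
      \<open>del: add_0\<close> below.\<close>
    have [simp]: "0 + s *\<^sub>R axis 1 1 = (vector [s, 0] :: real ^ 2)"
      and [simp]: "vector [r, 0] + s *\<^sub>R axis 2 1 = (vector [r, s] :: real ^ 2)" for r s :: real
      by (simp_all add: vec_eq_iff forall_2 axis_def)
    have [simp]: "vector [\<xi> $ 1, \<xi> $ 2] = \<xi>"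
      by (simp add: vec_eq_iff forall_2)
    have "(LBINT s=0..\<xi> $ 1. G (vector [s, 0])) = B (vector [\<xi> $ 1, 0]) - B 0"
      using LBINT_partial_line[of B 1 "\<xi> $ 1" 0] B_diff G_cont by (simp add: B1 del: add_0)
    moreover have "(LBINT s=0..\<xi> $ 2. H (vector [\<xi> $ 1, s])) = B \<xi> - B (vector [\<xi> $ 1, 0])"
      using LBINT_partial_line[of B 2 "\<xi> $ 2" "vector [\<xi> $ 1, 0]"] B_diff H_cont by (simp add: B2)
    ultimately show ?thesis by simp
  qed
  have norm_U: "(norm (U \<xi>))\<^sup>2 = ?u 1 \<xi> * ?u 1 \<xi> + ?u 2 \<xi> * ?u 2 \<xi>" for \<xi>
    by (simp add: power2_norm_eq_inner inner_vec_def sum_2)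
  show ?thesis
    \<comment> \<open>The constant is the value of \<open>B\<close> at the origin, where the path
      starts.\<close>
    by (intro exI[of _ "B 0"] allI trans[OF _ B_line]) (simp add: B_def norm_U)
qed

end
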